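(* Let $X$ be a nonempty set, let $S$ be a constant rich subsemigroup of $P(X)$, and let $\alpha,\beta\in S$. Then $\alpha\sim_c\beta$ in $S$ if and only if there are $\phi,\psi\in S^1$ such that $\phi$ is an rp-homomorphism from $\Gamma(\alpha)$ to $\Gamma(\beta)$ and $\psi$ is an rp-homomorphism from $\Gamma(\beta)$ to $\Gamma(\alpha)$.
   Context: Conjugacy. For a semigroup $S$, $S^1$ is $S$ if $S$ is a monoid, and $S$ with an identity adjoined otherwise (for constant rich $S\leq P(X)$ this identity is regarded as $\mathrm{id}_X$). If $S$ has a zero $0$ and $0\ne a\in S$, let $\mathbb{P}(a)=\{g\in S:(ma)g\neq 0\text{ for all }ma\in S^1a\setminus\{0\}\}$, and $\mathbb{P}(0)=\{0\}$; if $S$ has no zero, $\mathbb{P}(a)=S$ for all $a$. Put $\mathbb{P}^1(a)=\mathbb{P}(a)\cup\{1\}$. Then $a\sim_c b$ in $S$ iff there are $g\in\mathbb{P}^1(a)$, $h\in\mathbb{P}^1(b)$ with $ag=gb$ and $bh=ha$. $P(X)$ is the semigroup of all partial maps from $X$ to $X$, written on the right and composed left to right. A subsemigroup $S$ of $P(X)$ is constant rich if for every $x\in X$ there is $\alpha\in S$ with $\mathrm{im}(\alpha)=\{x\}$. For $\alpha\in P(X)$, $\Gamma(\alpha)$ is the digraph with vertex set $X$ and an arc $(x,y)$ iff $x\in\mathrm{dom}(\alpha)$ and $x\alpha=y$. A vertex $x$ of a digraph is terminal if there is no arc $(x,y)$. For digraphs $\Gamma_1=(X_1,R_1)$ and $\Gamma_2=(X_2,R_2)$,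 a partial map $\phi$ from $X_1$ to $X_2$ is an rp-homomorphism (restrictive partial homomorphism) from $\Gamma_1$ to $\Gamma_2$ if for all $x,y\in X_1$: (a) if $(x,y)\in R_1$, then $x,y\in\mathrm{dom}(\phi)$ and $(x\phi,y\phi)\in R_2$; (b) if $x$ is terminal in $\Gamma_1$ and $x\in\mathrm{dom}(\phi)$, then $x\phi$ is terminal in $\Gamma_2$. *)

theory Defs
  imports "Graph_Theory.Pair_Digraph"
begin

section \<open>Semigroups and conjugacy\<close>

text \<open>A semigroup is given by a carrier \<open>S\<close> and a multiplication \<open>f\<close>; no identity is part of
  the data.\<close>

definition semigroup_on :: "('s \<Rightarrow> 's \<Rightarrow> 's) \<Rightarrow> 's set \<Rightarrow> bool" where
  "semigroup_on f S \<longleftrightarrow> S \<noteq> {} \<and> (\<forall>a\<in>S. \<forall>b\<in>S. f a b \<in> S) \<and>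
     (\<forall>a\<in>S. \<forall>b\<in>S. \<forall>c\<in>S. f (f a b) c = f a (f b c))"

definition is_identity :: "('s \<Rightarrow> 's \<Rightarrow> 's) \<Rightarrow> 's set \<Rightarrow> 's \<Rightarrow> bool" where
  "is_identity f S e \<longleftrightarrow> e \<in> S \<and> (\<forall>a\<in>S. f e a = a \<and> f a e = a)"

definition is_zero :: "('s \<Rightarrow> 's \<Rightarrow> 's) \<Rightarrow> 's set \<Rightarrow> 's \<Rightarrow> bool" where
  "is_zero f S z \<longleftrightarrow> z \<in> S \<and> (\<forall>a\<in>S. f z a = z \<and> f a z = z)"

text \<open>\<open>S\<^sup>1\<close> lives on the option type: \<open>Some a\<close> stands for \<open>a \<in> S\<close>, and \<open>None\<close> is the adjoined
  identity, which belongs to the carrier only if \<open>S\<close> is not already a monoid.\<close>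

definition S1 :: "('s \<Rightarrow> 's \<Rightarrow> 's) \<Rightarrow> 's set \<Rightarrow> 's option set" where
  "S1 f S = (if \<exists>e. is_identity f S e then Some ` S else insert None (Some ` S))"

fun mult1 :: "('s \<Rightarrow> 's \<Rightarrow> 's) \<Rightarrow> 's option \<Rightarrow> 's option \<Rightarrow> 's option" where
  "mult1 f None y = y"
| "mult1 f x None = x"
| "mult1 f (Some a) (Some b) = Some (f a b)"

definition one1 :: "('s \<Rightarrow> 's \<Rightarrow> 's) \<Rightarrow> 's set \<Rightarrow> 's option" where
  "one1 f S = (if \<exists>e. is_identity f S e then Some (THE e. is_identity f S e) else None)"

text \<open>The left ideal \<open>S\<^sup>1a\<close>, which is a subset of \<open>S\<close> for \<open>a \<in> S\<close>.\<close>

definition left_ideal1 :: "('s \<Rightarrow> 's \<Rightarrow> 's) \<Rightarrow> 's set \<Rightarrow> 's \<Rightarrow> 's set" where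
  "left_ideal1 f S a = {b. \<exists>m\<in>S1 f S. mult1 f m (Some a) = Some b}"

text \<open>A semigroup has at most one zero, so \<open>is_zero f S x\<close> expresses \<open>x = 0\<close>.\<close>

definition conj_P :: "('s \<Rightarrow> 's \<Rightarrow> 's) \<Rightarrow> 's set \<Rightarrow> 's \<Rightarrow> 's set" where
  "conj_P f S a =
     (if \<exists>z. is_zero f S z then
        (if is_zero f S a then {a}
         else {g\<in>S. \<forall>b\<in>left_ideal1 f S a. \<not> is_zero f S b \<longrightarrow> \<not> is_zero f S (f b g)})
      else S)"

definition conj_P1 :: "('s \<Rightarrow> 's \<Rightarrow> 's) \<Rightarrow> 's set \<Rightarrow> 's \<Rightarrow> 's option set" where
  "conj_P1 f S a = insert (one1 f S) (Some ` conj_P f S a)"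

definition conj_c :: "('s \<Rightarrow> 's \<Rightarrow> 's) \<Rightarrow> 's set \<Rightarrow> 's \<Rightarrow> 's \<Rightarrow> bool" where
  "conj_c f S a b \<longleftrightarrow>
     (\<exists>g\<in>conj_P1 f S a. \<exists>h\<in>conj_P1 f S b.
        mult1 f (Some a) g = mult1 f g (Some b) \<and> mult1 f (Some b) h = mult1 f h (Some a))"


section \<open>Partial maps\<close>

definition pmaps_between :: "'a set \<Rightarrow> 'b set \<Rightarrow> ('a \<rightharpoonup> 'b) set" where
  "pmaps_between X Y = {\<alpha>. dom \<alpha> \<subseteq> X \<and> ran \<alpha> \<subseteq> Y}"

abbreviation pmaps :: "'a set \<Rightarrow> ('a \<rightharpoonup> 'a) set" where
  "pmaps X \<equiv> pmaps_between X X"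

text \<open>Maps are written on the right and composed left to right, so \<open>\<alpha>\<close> is applied first.\<close>

definition pcomp :: "('a \<rightharpoonup> 'a) \<Rightarrow> ('a \<rightharpoonup> 'a) \<Rightarrow> ('a \<rightharpoonup> 'a)" where
  "pcomp \<alpha> \<beta> = \<beta> \<circ>\<^sub>m \<alpha>"

definition id_pmap :: "'a set \<Rightarrow> ('a \<rightharpoonup> 'a)" where
  "id_pmap X = (\<lambda>x. if x \<in> X then Some x else None)"

definition pmap_subsemigroup :: "'a set \<Rightarrow> ('a \<rightharpoonup> 'a) set \<Rightarrow> bool" where
  "pmap_subsemigroup X S \<longleftrightarrow> S \<subseteq> pmaps X \<and> semigroup_on pcomp S"

definition constant_rich :: "'a set \<Rightarrow> ('a \<rightharpoonup> 'a) set \<Rightarrow> bool" where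
  "constant_rich X S \<longleftrightarrow> (\<forall>x\<in>X. \<exists>\<alpha>\<in>S. ran \<alpha> = {x})"

text \<open>Elements of \<open>S\<^sup>1\<close> regarded as partial maps: the adjoined identity becomes the identity
  map of \<open>X\<close>.\<close>

fun as_pmap :: "'a set \<Rightarrow> ('a \<rightharpoonup> 'a) option \<Rightarrow> ('a \<rightharpoonup> 'a)" where
  "as_pmap X None = id_pmap X"
| "as_pmap X (Some \<alpha>) = \<alpha>"

lemma as_pmap_mult1:
  assumes "S \<subseteq> pmaps X" "p \<in> S1 pcomp S" "q \<in> S1 pcomp S"
  shows "as_pmap X (mult1 pcomp p q) = pcomp (as_pmap X p) (as_pmap X q)"
proof -
  have l: "pcomp (id_pmap X) \<alpha> = \<alpha>" if "dom \<alpha> \<subseteq> X" for \<alpha> :: "'a \<rightharpoonup> 'a"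
  proof
    fix x
    show "pcomp (id_pmap X) \<alpha> x = \<alpha> x"
      using that by (cases "\<alpha> x") (auto simp: pcomp_def id_pmap_def map_comp_def dom_def)
  qed
  have r: "pcomp \<alpha> (id_pmap X) = \<alpha>" if "ran \<alpha> \<subseteq> X" for \<alpha> :: "'a \<rightharpoonup> 'a"
  proof
    fix x
    show "pcomp \<alpha> (id_pmap X) x = \<alpha> x"
      using that by (cases "\<alpha> x") (auto simp: pcomp_def id_pmap_def map_comp_def ran_def)
  qed
  have *: "dom (as_pmap X p) \<subseteq> X \<and> ran (as_pmap X p) \<subseteq> X" if "p \<in> S1 pcomp S" for p
  proof (cases p)
    case None
    then show ?thesis by (auto simp: id_pmap_def ran_def split: if_splits)
  next
    case (Some \<alpha>)
    with that have "\<alpha> \<in> S" by (auto simp: S1_def split: if_splits)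
    with assms(1) Some show ?thesis by (simp add: pmaps_between_def) blast
  qed
  show ?thesis
    using l r *[OF assms(2)] *[OF assms(3)] by (cases p; cases q) auto
qed


section \<open>Digraphs and rp-homomorphisms\<close>

definition pmap_digraph :: "'a set \<Rightarrow> ('a \<rightharpoonup> 'a) \<Rightarrow> 'a pair_pre_digraph" where
  "pmap_digraph X \<alpha> = \<lparr> pverts = X, parcs = {(x, y). \<alpha> x = Some y} \<rparr>"

definition terminal :: "'a pair_pre_digraph \<Rightarrow> 'a \<Rightarrow> bool" where
  "terminal G x \<longleftrightarrow> x \<in> pverts G \<and> (\<nexists>y. (x, y) \<in> parcs G)"

definition rp_homomorphism ::
    "'a pair_pre_digraph \<Rightarrow> 'b pair_pre_digraph \<Rightarrow> ('a \<rightharpoonup> 'b) \<Rightarrow> bool" where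
  "rp_homomorphism G H \<phi> \<longleftrightarrow>
     \<phi> \<in> pmaps_between (pverts G) (pverts H) \<and>
     (\<forall>x\<in>pverts G. \<forall>y\<in>pverts G. (x, y) \<in> parcs G \<longrightarrow>
        x \<in> dom \<phi> \<and> y \<in> dom \<phi> \<and> (the (\<phi> x), the (\<phi> y)) \<in> parcs H) \<and>
     (\<forall>x\<in>pverts G. terminal G x \<and> x \<in> dom \<phi> \<longrightarrow> terminal H (the (\<phi> x)))"

end

theory Submission
  imports Defs
begin

text \<open>For a nonempty \<open>\<alpha>\<close> the constants in \<open>S\<close> turn membership of \<open>g\<close> in \<open>\<bbbP>(\<alpha>)\<close> into
  \<open>im \<alpha> \<subseteq> dom g\<close>: if \<open>x\<alpha> = y\<close> and \<open>c \<in> S\<close> has image \<open>{x}\<close>, then \<open>c\<alpha>\<close> has image \<open>{y}\<close>,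
  so \<open>c\<alpha>g\<close> is nonempty iff \<open>y \<in> dom g\<close>. Under this domain condition, \<open>\<alpha>g = g\<beta>\<close> says
  precisely that \<open>g\<close> is an rp-homomorphism from \<open>\<Gamma>(\<alpha>)\<close> to \<open>\<Gamma>(\<beta>)\<close>; so each of the
  two conditions in \<open>\<alpha> \<sim>\<^sub>c \<beta>\<close> corresponds to one rp-homomorphism.\<close>

section \<open>rp-homomorphisms as intertwining partial maps\<close>

lemma pcomp_simp: "pcomp f g x = (case f x of None \<Rightarrow> None | Some y \<Rightarrow> g y)"
  by (simp add: pcomp_def map_comp_def)

text \<open>Evaluate \<alpha>\<phi> = \<phi>\<beta> at a vertex x. If x\<alpha> is defined, the
  range condition makes the left side defined and the equation says that \<phi> preserves the arc at
  x. If x is terminal, the left side is undefined and the equation says that x\<phi>, when defined,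
  is terminal.\<close>

lemma rp_homomorphism_pmap_digraph_iff:
  assumes "\<alpha> \<in> pmaps X" "\<beta> \<in> pmaps X" "\<phi> \<in> pmaps X"
  shows "rp_homomorphism (pmap_digraph X \<alpha>) (pmap_digraph X \<beta>) \<phi> \<longleftrightarrow>
    ran \<alpha> \<subseteq> dom \<phi> \<and> pcomp \<alpha> \<phi> = pcomp \<phi> \<beta>"
proof
  have \<alpha>: "x \<in> X \<and> y \<in> X" if "\<alpha> x = Some y" for x y
    using assms(1) that by (auto simp: pmaps_between_def dom_def ran_def)
  have \<phi>: "x \<in> X \<and> y \<in> X" if "\<phi> x = Some y" for x y
    using assms(3) that by (auto simp: pmaps_between_def dom_def ran_def)
  {
    assume rp: "rp_homomorphism (pmap_digraph X \<alpha>) (pmap_digraph X \<beta>) \<phi>"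
    have arc: "\<exists>u v. \<phi> x = Some u \<and> \<phi> y = Some v \<and> \<beta> u = Some v" if "\<alpha> x = Some y" for x y
      using rp \<alpha>[OF that] that unfolding rp_homomorphism_def pmap_digraph_def by fastforce
    have terminal: "\<beta> u = None" if "\<alpha> x = None" "\<phi> x = Some u" for x u
      using rp \<phi>[OF that(2)] that
      by (auto simp: rp_homomorphism_def pmap_digraph_def terminal_def)
    have "pcomp \<alpha> \<phi> x = pcomp \<phi> \<beta> x" for x
      using arc[of x] terminal[of x] by (cases "\<alpha> x"; cases "\<phi> x") (auto simp: pcomp_simp)
    moreover have "ran \<alpha> \<subseteq> dom \<phi>"
      using arc by (fastforce simp: ran_def)
    ultimately show "ran \<alpha> \<subseteq> dom \<phi> \<and> pcomp \<alpha> \<phi> = pcomp \<phi> \<beta>"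
      by auto
  next
    assume r: "ran \<alpha> \<subseteq> dom \<phi> \<and> pcomp \<alpha> \<phi> = pcomp \<phi> \<beta>"
    then have eq: "pcomp \<alpha> \<phi> x = pcomp \<phi> \<beta> x" for x
      by simp
    have arc: "\<exists>u v. \<phi> x = Some u \<and> \<phi> y = Some v \<and> \<beta> u = Some v" if xy: "\<alpha> x = Some y" for x y
    proof -
      \<comment> \<open>Only y is in \<open>dom \<phi>\<close> by assumption. Since x\<alpha>\<phi>
        = v is defined, so is x\<phi>\<beta>, which puts x into \<open>dom \<phi>\<close> as
        well.\<close>
      obtain v where "\<phi> y = Some v"
        using r ranI[of \<alpha> x y] xy by blast
      with eq[of x] xy show ?thesis
        by (cases "\<phi> x") (auto simp: pcomp_simp intro: sym)
    qed
    have terminal: "\<beta> u = None" if "\<alpha> x = None" "\<phi> x = Some u" for x u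
      using eq[of x] that by (simp add: pcomp_simp)
    show "rp_homomorphism (pmap_digraph X \<alpha>) (pmap_digraph X \<beta>) \<phi>"
      using assms(3) arc terminal \<phi>
      by (fastforce simp: rp_homomorphism_def pmap_digraph_def terminal_def)
  }
qed

section \<open>Constants and the identity of a constant rich semigroup\<close>

locale constant_rich_semigroup =
  fixes X :: "'a set" and S :: "('a \<rightharpoonup> 'a) set"
  assumes subsemigroup: "pmap_subsemigroup X S"
    and rich: "constant_rich X S"
begin

lemma in_pmaps: "\<alpha> \<in> S \<Longrightarrow> \<alpha> \<in> pmaps X"
  using subsemigroup by (auto simp: pmap_subsemigroup_def)

lemma in_X: "\<alpha> \<in> S \<Longrightarrow> \<alpha> x = Some y \<Longrightarrow> x \<in> X \<and> y \<in> X"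
  using in_pmaps[of \<alpha>] by (auto simp: pmaps_between_def dom_def ran_def)

lemma pcomp_closed: "\<alpha> \<in> S \<Longrightarrow> \<beta> \<in> S \<Longrightarrow> pcomp \<alpha> \<beta> \<in> S"
  using subsemigroup by (auto simp: pmap_subsemigroup_def semigroup_on_def)

text \<open>A constant may be partial on X; the point \<open>w\<close> is one where it is defined,
  so that products beginning with \<open>c\<close> can be evaluated there.\<close>

lemma obtain_constant:
  assumes "x \<in> X"
  obtains c w where "c \<in> S" "c w = Some x" "\<And>u v. c u = Some v \<Longrightarrow> v = x"
proof -
  obtain c where c: "c \<in> S" "ran c = {x}"
    using rich assms by (auto simp: constant_rich_def)
  then have "x \<in> ran c"
    by simp
  then obtain w where "c w = Some x"
    by (auto simp: ran_def)
  moreover have "v = x" if "c u = Some v" for u v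
    using c(2) ranI[of c u v] that by simp
  ultimately show thesis
    using that c(1) by blast
qed

text \<open>If c has image {x}, then ce = c forces xe = x. Hence the identity of \<open>S1\<close>
  acts as the identity map of X whether it is adjoined or already in S.\<close>

lemma identity_eq_id_pmap:
  assumes "is_identity pcomp S e"
  shows "e = id_pmap X"
proof
  fix x
  have e: "e \<in> S" and eid: "\<And>a. a \<in> S \<Longrightarrow> pcomp a e = a"
    using assms by (auto simp: is_identity_def)
  show "e x = id_pmap X x"
  proof (cases "x \<in> X")
    case True
    then obtain c w where "c \<in> S" "c w = Some x"
      by (rule obtain_constant)
    with eid[of c] have "e x = Some x"
      by (auto dest!: fun_cong[where x = w] simp: pcomp_simp)
    with True show ?thesis
      by (simp add: id_pmap_def)
  next
    case False
    with in_X[OF e] show ?thesis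
      by (cases "e x") (auto simp: id_pmap_def)
  qed
qed

lemma as_pmap_one1: "as_pmap X (one1 pcomp S) = id_pmap X"
proof (cases "\<exists>e. is_identity pcomp S e")
  case True
  then have "is_identity pcomp S (id_pmap X)"
    using identity_eq_id_pmap by metis
  then have "(THE e. is_identity pcomp S e) = id_pmap X"
    using identity_eq_id_pmap by blast
  with True show ?thesis
    by (simp add: one1_def)
qed (simp add: one1_def)

lemma one1_in_S1: "one1 pcomp S \<in> S1 pcomp S"
proof (cases "\<exists>e. is_identity pcomp S e")
  case True
  then obtain e where e: "is_identity pcomp S e"
    by blast
  then have "(THE e. is_identity pcomp S e) = e"
    using identity_eq_id_pmap by blast
  with True have "one1 pcomp S = Some e"
    by (simp add: one1_def)
  moreover have "e \<in> S"
    using e by (simp add: is_identity_def)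
  ultimately show ?thesis
    by (simp add: S1_def)
qed (simp add: one1_def S1_def)

text \<open>\<open>None\<close> is in the carrier only when S has no identity of its own, and then
  it is \<open>one1\<close>, which always belongs to \<open>conj_P1\<close>.\<close>

lemma S1_cases:
  assumes "p \<in> S1 pcomp S"
  obtains "p = None" "one1 pcomp S = None" | g where "g \<in> S" "p = Some g"
  using assms by (auto simp: S1_def one1_def split: if_splits)

lemma as_pmap_in_pmaps: "p \<in> S1 pcomp S \<Longrightarrow> as_pmap X p \<in> pmaps X"
  by (erule S1_cases) 
    (auto simp: in_pmaps, auto simp: pmaps_between_def id_pmap_def dom_def ran_def split: if_splits)

text \<open>\<open>as_pmap\<close> need not be injective on options, since \<open>None\<close> and
  \<open>Some (id_pmap X)\<close> have the same image. But both products contain a factor from S, so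
  they are \<open>Some\<close> values, and there it is injective.\<close>

lemma mult1_eq_iff:
  assumes "\<alpha> \<in> S" "\<beta> \<in> S" "p \<in> S1 pcomp S"
  shows "mult1 pcomp (Some \<alpha>) p = mult1 pcomp p (Some \<beta>) \<longleftrightarrow>
    pcomp \<alpha> (as_pmap X p) = pcomp (as_pmap X p) \<beta>"
proof -
  have Some: "Some \<gamma> \<in> S1 pcomp S" if "\<gamma> \<in> S" for \<gamma>
    using that by (simp add: S1_def)
  have "S \<subseteq> pmaps X"
    using in_pmaps by blast
  from as_pmap_mult1[OF this Some[OF assms(1)] assms(3)] as_pmap_mult1[OF this assms(3) Some[OF assms(2)]]
  show ?thesis
    by (cases p) auto
qed

section \<open>Zeros and the sets \<open>conj_P\<close>\<close>

lemma is_zero_iff_empty: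
  assumes "Map.empty \<in> S"
  shows "is_zero pcomp S z \<longleftrightarrow> z = Map.empty"
proof
  assume "is_zero pcomp S z"
  then have "pcomp Map.empty z = z"
    using assms by (auto simp: is_zero_def)
  then show "z = Map.empty"
    by (simp add: pcomp_def)
next
  assume "z = Map.empty"
  with assms show "is_zero pcomp S z"
    by (simp add: is_zero_def pcomp_def)
qed

text \<open>This happens only for \<open>X = {x}\<close> and \<open>S = {id\<^sub>X}\<close>.\<close>

lemma nonempty_zero_imp_trivial:
  assumes z: "is_zero pcomp S z" and "z \<noteq> Map.empty"
  shows "S = {z}"
proof -
  have zS: "z \<in> S" and zl: "\<And>a. a \<in> S \<Longrightarrow> pcomp z a = z" and zr: "\<And>a. a \<in> S \<Longrightarrow> pcomp a z = z"
    using z by (auto simp: is_zero_def)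
  obtain u v where uv: "z u = Some v"
    using assms(2) by (meson ext option.exhaust)
  have X: "x = v" if x: "x \<in> X" for x
  proof -
    obtain c w where c: "c \<in> S" "\<And>u v. c u = Some v \<Longrightarrow> v = x"
      using obtain_constant[OF x] by metis
    \<comment> \<open>Evaluating zc = z at u shows that c fixes v, while x is the only value of
      c.\<close>
    have "c v = Some v"
      using fun_cong[OF zl[OF c(1)], of u] uv by (simp add: pcomp_simp)
    then show ?thesis
      using c(2) by blast
  qed
  have pt: "a = [v \<mapsto> v]" if a: "a \<in> S" for a
  proof
    fix x
    \<comment> \<open>As v is the only point of X, a is empty or sends v to v; az = z at v rules out
      the empty map.\<close>
    have "u = v"
      using in_X[OF zS uv] X by blast
    then obtain y where "a v = Some y"
      using fun_cong[OF zr[OF a], of u] uv by (cases "a v") (auto simp: pcomp_simp)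
    then show "a x = [v \<mapsto> v] x"
      using in_X[OF a] X by (cases "a x") auto
  qed
  with zS show ?thesis
    by blast
qed

text \<open>If the empty map is in S, it is the zero, and only nonzero \<alpha> needs the argument
  with constants. If not, \<open>conj_P\<close> is all of S and every g in S meets the domain
  condition.\<close>

lemma conj_P_iff:
  assumes \<alpha>: "\<alpha> \<in> S"
  shows "g \<in> conj_P pcomp S \<alpha> \<longleftrightarrow>
    g \<in> S \<and> (if \<alpha> = Map.empty then g = Map.empty else ran \<alpha> \<subseteq> dom g)"
proof -
  \<comment> \<open>The hypothesis speaks of empty maps rather than zeros, so that it serves both
    with and without the empty map in S.\<close>
  have subset: "ran \<alpha> \<subseteq> dom g"
    if g: "\<And>c. c \<in> S \<Longrightarrow> pcomp c \<alpha> \<noteq> Map.empty \<Longrightarrow> pcomp (pcomp c \<alpha>) g \<noteq> Map.empty"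
  proof
    fix y assume "y \<in> ran \<alpha>"
    then obtain x where x: "\<alpha> x = Some y"
      by (auto simp: ran_def)
    with in_X[OF \<alpha>] have "x \<in> X"
      by blast
    then obtain c w where c: "c \<in> S" "c w = Some x" "\<And>u v. c u = Some v \<Longrightarrow> v = x"
      by (rule obtain_constant) blast
    have "pcomp c \<alpha> w \<noteq> None"
      using c(2) x by (simp add: pcomp_simp)
    then have "pcomp c \<alpha> \<noteq> Map.empty"
      by auto
    from g[OF c(1) this] obtain u where "pcomp (pcomp c \<alpha>) g u \<noteq> None"
      by (meson ext)
    \<comment> \<open>Any point at which c\<alpha>g is defined is sent by c to x and then by
      \<alpha> to y.\<close>
    then show "y \<in> dom g"
      using c(3) x by (auto simp: pcomp_simp split: option.splits)
  qed
  show ?thesis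
  proof (cases "Map.empty \<in> S")
    case True
    note zero = is_zero_iff_empty[OF True]
    show ?thesis
    proof (cases "\<alpha> = Map.empty")
      case True
      then show ?thesis
        using zero \<alpha> by (auto simp: conj_P_def)
    next
      case False
      have "g \<in> conj_P pcomp S \<alpha> \<longleftrightarrow> g \<in> S \<and>
          (\<forall>b\<in>left_ideal1 pcomp S \<alpha>. b \<noteq> Map.empty \<longrightarrow> pcomp b g \<noteq> Map.empty)"
        using False by (simp add: conj_P_def zero)
      also have "\<dots> \<longleftrightarrow> g \<in> S \<and> ran \<alpha> \<subseteq> dom g"
      proof (intro conj_cong refl iffI ballI impI)
        assume *: "\<forall>b\<in>left_ideal1 pcomp S \<alpha>. b \<noteq> Map.empty \<longrightarrow> pcomp b g \<noteq> Map.empty"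
        show "ran \<alpha> \<subseteq> dom g"
        proof (rule subset)
          fix c assume c: "c \<in> S" "pcomp c \<alpha> \<noteq> Map.empty"
          have "Some c \<in> S1 pcomp S" "mult1 pcomp (Some c) (Some \<alpha>) = Some (pcomp c \<alpha>)"
            using c(1) by (simp_all add: S1_def)
          then have "pcomp c \<alpha> \<in> left_ideal1 pcomp S \<alpha>"
            unfolding left_ideal1_def by blast
          with * c(2) show "pcomp (pcomp c \<alpha>) g \<noteq> Map.empty"
            by blast
        qed
      next
        fix b assume r: "ran \<alpha> \<subseteq> dom g" and "b \<in> left_ideal1 pcomp S \<alpha>" and b: "b \<noteq> Map.empty"
        then obtain m where "mult1 pcomp m (Some \<alpha>) = Some b"
          by (auto simp: left_ideal1_def)
        \<comment> \<open>Left multiplication cannot enlarge the image, so any value of b already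
          lies in \<open>dom g\<close>.\<close>
        then have "ran b \<subseteq> ran \<alpha>"
          by (cases m) (auto simp: pcomp_simp ran_def split: option.splits)
        moreover obtain x y where xy: "b x = Some y"
          using b by (meson ext option.exhaust)
        ultimately have "y \<in> dom g"
          using r ranI[of b x y] xy by blast
        with xy have "pcomp b g x \<noteq> None"
          by (auto simp: pcomp_simp)
        then show "pcomp b g \<noteq> Map.empty"
          by auto
      qed
      finally show ?thesis
        using False by simp
    qed
  next
    case False
    \<comment> \<open>Without a zero this is the definition. A zero other than the empty map leaves
      \<alpha> as the only element of S, and the set {\<alpha>} prescribed for a zero \<alpha> is
      again S.\<close>
    have "conj_P pcomp S \<alpha> = S"
    proof (cases "\<exists>z. is_zero pcomp S z")
      case True
      then obtain z where z: "is_zero pcomp S z"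
        by blast
      with False have "z \<noteq> Map.empty"
        by (auto simp: is_zero_def)
      with z have "S = {z}"
        by (rule nonempty_zero_imp_trivial)
      with \<alpha> z show ?thesis
        by (auto simp: conj_P_def)
    qed (simp add: conj_P_def)
    \<comment> \<open>Each product c\<alpha>g lies in S and so is nonempty.\<close>
    moreover have "ran \<alpha> \<subseteq> dom g" if "g \<in> S"
      using that False \<alpha> pcomp_closed by (intro subset) metis
    moreover have "\<alpha> \<noteq> Map.empty"
      using \<alpha> False by blast
    ultimately show ?thesis
      by auto
  qed
qed

section \<open>Conjugacy through rp-homomorphisms\<close>

lemma intertwiner_iff_rp_homomorphism:
  assumes \<alpha>: "\<alpha> \<in> S" and \<beta>: "\<beta> \<in> S"
  shows "(\<exists>g\<in>conj_P1 pcomp S \<alpha>. mult1 pcomp (Some \<alpha>) g = mult1 pcomp g (Some \<beta>)) \<longleftrightarrow>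
    (\<exists>\<phi>\<in>S1 pcomp S. rp_homomorphism (pmap_digraph X \<alpha>) (pmap_digraph X \<beta>) (as_pmap X \<phi>))"
proof -
  have rp: "rp_homomorphism (pmap_digraph X \<alpha>) (pmap_digraph X \<beta>) (as_pmap X p) \<longleftrightarrow>
      ran \<alpha> \<subseteq> dom (as_pmap X p) \<and> mult1 pcomp (Some \<alpha>) p = mult1 pcomp p (Some \<beta>)"
    if "p \<in> S1 pcomp S" for p
    using rp_homomorphism_pmap_digraph_iff[OF in_pmaps[OF \<alpha>] in_pmaps[OF \<beta>] as_pmap_in_pmaps[OF that]]
      mult1_eq_iff[OF \<alpha> \<beta> that] by simp
  show ?thesis
  proof
    assume "\<exists>g\<in>conj_P1 pcomp S \<alpha>. mult1 pcomp (Some \<alpha>) g = mult1 pcomp g (Some \<beta>)"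
    then obtain g where g: "g \<in> conj_P1 pcomp S \<alpha>"
        "mult1 pcomp (Some \<alpha>) g = mult1 pcomp g (Some \<beta>)"
      by blast
    have "g \<in> S1 pcomp S \<and> ran \<alpha> \<subseteq> dom (as_pmap X g)"
    proof (cases "g = one1 pcomp S")
      case True
      have "ran \<alpha> \<subseteq> dom (id_pmap X)"
        using in_X[OF \<alpha>] by (auto simp: ran_def id_pmap_def)
      with True show ?thesis
        by (simp add: one1_in_S1 as_pmap_one1)
    next
      case False
      with g(1) obtain g' where "g = Some g'" "g' \<in> conj_P pcomp S \<alpha>"
        by (auto simp: conj_P1_def)
      then show ?thesis
        by (auto simp: conj_P_iff[OF \<alpha>] S1_def split: if_splits)
    qed
    with rp g(2) show "\<exists>\<phi>\<in>S1 pcomp S.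
        rp_homomorphism (pmap_digraph X \<alpha>) (pmap_digraph X \<beta>) (as_pmap X \<phi>)"
      by blast
  next
    assume "\<exists>\<phi>\<in>S1 pcomp S.
        rp_homomorphism (pmap_digraph X \<alpha>) (pmap_digraph X \<beta>) (as_pmap X \<phi>)"
    then obtain p where p: "p \<in> S1 pcomp S" "ran \<alpha> \<subseteq> dom (as_pmap X p)"
        "mult1 pcomp (Some \<alpha>) p = mult1 pcomp p (Some \<beta>)"
      using rp by blast
    show "\<exists>g\<in>conj_P1 pcomp S \<alpha>. mult1 pcomp (Some \<alpha>) g = mult1 pcomp g (Some \<beta>)"
    proof (cases "\<alpha> = Map.empty")
      case True
      \<comment> \<open>\<open>\<bbbP>(0) = {0}\<close>, so \<open>p\<close> itself need not be admissible here, but \<open>0\<close> is.\<close>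
      then have "Some \<alpha> \<in> conj_P1 pcomp S \<alpha>"
        using conj_P_iff[OF \<alpha>] \<alpha> by (simp add: conj_P1_def)
      moreover have "mult1 pcomp (Some \<alpha>) (Some \<alpha>) = mult1 pcomp (Some \<alpha>) (Some \<beta>)"
        using True by (simp add: pcomp_def)
      ultimately show ?thesis
        by blast
    next
      case False
      from p(1) have "p \<in> conj_P1 pcomp S \<alpha>"
      proof (cases rule: S1_cases)
        case (2 g)
        with p(2) False show ?thesis
          by (simp add: conj_P1_def conj_P_iff[OF \<alpha>])
      qed (simp add: conj_P1_def)
      with p(3) show ?thesis
        by blast
    qed
  qed
qed

end

theorem theorem3p8:
  fixes X :: "'a set" and S :: "('a \<rightharpoonup> 'a) set" and \<alpha> \<beta> :: "'a \<rightharpoonup> 'a"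
  assumes "X \<noteq> {}"
    and "pmap_subsemigroup X S"
    and "constant_rich X S"
    and "\<alpha> \<in> S" and "\<beta> \<in> S"
  shows "conj_c pcomp S \<alpha> \<beta> \<longleftrightarrow>
    (\<exists>\<phi>\<in>S1 pcomp S. \<exists>\<psi>\<in>S1 pcomp S.
       rp_homomorphism (pmap_digraph X \<alpha>) (pmap_digraph X \<beta>) (as_pmap X \<phi>) \<and>
       rp_homomorphism (pmap_digraph X \<beta>) (pmap_digraph X \<alpha>) (as_pmap X \<psi>))"
proof -
  interpret constant_rich_semigroup X S
    using assms(2,3) by unfold_locales
  \<comment> \<open>The conditions on g and on h share no witness, so they separate and the
    one-sided equivalence applies twice, with \<alpha> and \<beta> exchanged.\<close>
  have "conj_c pcomp S \<alpha> \<beta> \<longleftrightarrow>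
      (\<exists>g\<in>conj_P1 pcomp S \<alpha>. mult1 pcomp (Some \<alpha>) g = mult1 pcomp g (Some \<beta>)) \<and>
      (\<exists>h\<in>conj_P1 pcomp S \<beta>. mult1 pcomp (Some \<beta>) h = mult1 pcomp h (Some \<alpha>))"
    unfolding conj_c_def by blast
  then show ?thesis
    using intertwiner_iff_rp_homomorphism[OF assms(4,5)]
      intertwiner_iff_rp_homomorphism[OF assms(5,4)] by blast
qed

end
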